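(* Let $m\geq 2$ and $r>0$. The only compact and connected hypersurface $\Sigma$ in $\mathbb{R}^{m+1}$ such that at each point $q\in\Sigma$ its intersections with $2$ orthonormal normal hyperplanes are pieces of spheres with radius $r$ is a sphere with radius $r$. That is, a compact and connected hypersurface $\Sigma$ of $\mathbb{R}^{m+1}$ is a round $m$-sphere of radius $r$ if and only if for each $q\in\Sigma$ there are two affine hyperplanes through $q$, both normal to $\Sigma$ at $q$ and with mutually orthonormal normal vectors at $q$, each of whose intersections with $\Sigma$ is a piece of a round $(m-1)$-sphere of radius $r$.
   Context: An affine hyperplane of Euclidean space through a point $q\in\Sigma$ is normal to $\Sigma$ at $q$ if its direction contains the normal line $T_q^{\bot}\Sigma$. Spheres are round spheres of arbitrary center ($1$-spheres are circles); a piece of a sphere is an open subset of it. *)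

theory Defs
  imports "HOL-Analysis.Analysis"
begin

text \<open>Differentiability classes are meant for open \<open>U\<close>: all iterated directional derivatives up to
  the given order exist and are continuous on \<open>U\<close>.\<close>

primrec Ck_on :: "nat \<Rightarrow> 'a::real_normed_vector set \<Rightarrow> ('a \<Rightarrow> 'b::real_normed_vector) \<Rightarrow> bool" where
  "Ck_on 0 U f \<longleftrightarrow> continuous_on U f"
| "Ck_on (Suc k) U f \<longleftrightarrow>
     (\<forall>x\<in>U. f differentiable (at x)) \<and> (\<forall>v. Ck_on k U (\<lambda>x. frechet_derivative f (at x) v))"

definition smooth_on :: "'a::real_normed_vector set \<Rightarrow> ('a \<Rightarrow> 'b::real_normed_vector) \<Rightarrow> bool" where
  "smooth_on U f \<longleftrightarrow> (\<forall>k. Ck_on k U f)"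

text \<open>Smooth embedded hypersurfaces without boundary: locally regular level sets.\<close>

definition hypersurface :: "'a::euclidean_space set \<Rightarrow> bool" where
  "hypersurface M \<longleftrightarrow>
     (\<forall>p\<in>M. \<exists>U f. open U \<and> p \<in> U \<and> smooth_on U (f :: 'a \<Rightarrow> real) \<and>
        (\<forall>x\<in>U. f x = 0 \<longrightarrow> frechet_derivative f (at x) \<noteq> (\<lambda>v. 0)) \<and>
        M \<inter> U = {x \<in> U. f x = 0})"

definition tangent_space :: "'a::euclidean_space set \<Rightarrow> 'a \<Rightarrow> 'a set" where
  "tangent_space M q =
     {v. \<exists>e>0. \<exists>\<gamma>. smooth_on {-e<..<e} \<gamma> \<and> \<gamma> ` {-e<..<e} \<subseteq> M \<and> \<gamma> (0::real) = q \<and>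
           (\<gamma> has_vector_derivative v) (at 0)}"

definition normal_line :: "'a::euclidean_space set \<Rightarrow> 'a \<Rightarrow> 'a set" where
  "normal_line M q = (tangent_space M q)\<^sup>\<bottom>"

definition direction :: "'a::real_vector set \<Rightarrow> 'a set" where
  "direction A = {x - y | x y. x \<in> A \<and> y \<in> A}"

definition hyperplane_with_unit_normal :: "'a::euclidean_space set \<Rightarrow> 'a \<Rightarrow> bool" where
  "hyperplane_with_unit_normal H u \<longleftrightarrow> norm u = 1 \<and> (\<exists>b. H = {x. u \<bullet> x = b})"

definition normal_hyperplane_at :: "'a::euclidean_space set \<Rightarrow> 'a \<Rightarrow> 'a set \<Rightarrow> bool" where
  "normal_hyperplane_at M q H \<longleftrightarrow> q \<in> H \<and> normal_line M q \<subseteq> direction H"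

text \<open>A round \<open>k\<close>-sphere lies in some affine subspace of dimension \<open>k + 1\<close> containing its center,
  not necessarily in the whole space.\<close>

definition round_sphere :: "nat \<Rightarrow> real \<Rightarrow> 'a::euclidean_space set \<Rightarrow> bool" where
  "round_sphere k r S \<longleftrightarrow>
     (\<exists>A c. affine A \<and> aff_dim A = int k + 1 \<and> c \<in> A \<and> S = A \<inter> sphere c r)"

definition piece_of_round_sphere :: "nat \<Rightarrow> real \<Rightarrow> 'a::euclidean_space set \<Rightarrow> bool" where
  "piece_of_round_sphere k r P \<longleftrightarrow> (\<exists>S. round_sphere k r S \<and> openin (top_of_set S) P)"

end

theory Submission
  imports Defs
begin

text \<open>The normal hyperplane sections are whole spheres, since they are compact and open in a connected
  sphere. If two points \<open>p\<close>, \<open>q\<close> of \<open>\<Sigma>\<close> realise the diameter, then \<open>p - q\<close> is normal at \<open>q\<close>, so \<open>p\<close>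
  and \<open>q\<close> both lie on a section through \<open>q\<close>; hence \<open>\<Sigma>\<close> has diameter at most \<open>2r\<close>. Any two sections, with
  centers \<open>c\<close> and \<open>d\<close>, contain \<open>c \<plusminus> v\<close> and \<open>d \<plusminus> v\<close> for a common vector \<open>v\<close> of length \<open>r\<close>, because
  the dimension is at least 3. The diameter bound then gives
  \<open>2|c - d|\<^sup>2 + 8r\<^sup>2 = |c - d + 2v|\<^sup>2 + |c - d - 2v|\<^sup>2 \<le> 8r\<^sup>2\<close>, so all sections have the same center \<open>c\<close> and
  \<open>\<Sigma>\<close> lies in the sphere around \<open>c\<close>. Finally, at a maximum of the linear form \<open>x \<mapsto> u \<bullet> x\<close> on \<open>\<Sigma>\<close> the
  vector \<open>u\<close> is normal, so the section there contains \<open>c + r u\<close>.\<close>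

section \<open>Spheres inside affine subspaces\<close>

text \<open>Since \<open>c\<close> is interior to the ball, this set is the relative frontier of the
  bounded convex slice \<open>cball c r \<inter> A\<close>. Such a frontier is connected except in
  dimension 1, where it is a pair of points.\<close>

lemma connected_affine_Int_sphere:
  fixes A :: "'a::euclidean_space set"
  assumes "affine A" "c \<in> A" "r > 0" "aff_dim A \<noteq> 1"
  shows "connected (A \<inter> sphere c r)"
proof -
  have "c \<in> interior (cball c r) \<inter> A"
    using assms by simp
  then have ne: "interior (cball c r) \<inter> A \<noteq> {}"
    by blast
  have "rel_frontier (cball c r \<inter> A) = frontier (cball c r) \<inter> A"
    using ne assms by (intro convex_affine_rel_frontier_Int) auto
  moreover have "aff_dim (cball c r \<inter> A) = aff_dim A"
    using ne assms aff_dim_convex_Int_nonempty_interior[of A "cball c r"]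
    by (simp add: affine_imp_convex Int_commute)
  moreover have "connected (rel_frontier (cball c r \<inter> A))"
    using assms calculation by (intro connected_sphere_gen)
      (auto simp: affine_imp_convex convex_Int bounded_Int)
  ultimately show ?thesis
    by (simp add: frontier_cball Int_commute)
qed

text \<open>Every line in \<open>A\<close> through \<open>c\<close> meets the sphere in two
  antipodal points. Both lie in \<open>H\<close>, so \<open>H\<close> contains the line.\<close>

lemma affine_subset_of_sphere_subset:
  fixes A :: "'a::euclidean_space set"
  assumes "affine A" "affine H" "c \<in> A" "r > 0" "aff_dim A \<ge> 1" and sub: "A \<inter> sphere c r \<subseteq> H"
  shows "A \<subseteq> H"
proof -
  have line: "c + s *\<^sub>R (x - c) \<in> H" if x: "x \<in> A" "x \<noteq> c" for x s
  proof -
    define t where "t = r / norm (x - c)"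
    have t: "t > 0" using x \<open>r > 0\<close> by (simp add: t_def)
    have "c + a *\<^sub>R (x - c) \<in> H" if "\<bar>a\<bar> = t" for a
    proof -
      have "c + a *\<^sub>R (x - c) = (1 - a) *\<^sub>R c + a *\<^sub>R x" by (simp add: algebra_simps)
      then have "c + a *\<^sub>R (x - c) \<in> A"
        using mem_affine[OF \<open>affine A\<close> \<open>c \<in> A\<close> x(1), of "1 - a" a] by simp
      moreover have "c + a *\<^sub>R (x - c) \<in> sphere c r"
        using that x by (simp add: dist_norm t_def)
      ultimately show ?thesis using sub by auto
    qed
    then have "c + t *\<^sub>R (x - c) \<in> H" "c + (- t) *\<^sub>R (x - c) \<in> H"
      using t by (metis abs_minus_cancel abs_of_pos)+
    \<comment> \<open>The weights sum to 1 and are chosen so that the parameters \<open>t\<close>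
      and \<open>-t\<close> average to \<open>s\<close>.\<close>
    then have "(1/2 + s/(2*t)) *\<^sub>R (c + t *\<^sub>R (x - c)) + (1/2 - s/(2*t)) *\<^sub>R (c + (- t) *\<^sub>R (x - c)) \<in> H"
      by (intro mem_affine[OF \<open>affine H\<close>]) auto
    also have "(1/2 + s/(2*t)) *\<^sub>R (c + t *\<^sub>R (x - c)) + (1/2 - s/(2*t)) *\<^sub>R (c + (- t) *\<^sub>R (x - c))
      = ((1/2 + s/(2*t)) + (1/2 - s/(2*t))) *\<^sub>R c
        + ((1/2 + s/(2*t)) * t - (1/2 - s/(2*t)) * t) *\<^sub>R (x - c)"
      unfolding scaleR_add_right scaleR_add_left scaleR_diff_left scaleR_scaleR by simp
    also have "(1/2 + s/(2*t)) * t - (1/2 - s/(2*t)) * t = s"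
      using t by (simp add: field_simps)
    finally show ?thesis by simp
  qed
  \<comment> \<open>The center determines no line by itself; it is reached as parameter 0 on the
    line through \<open>c\<close> and \<open>y\<close>.\<close>
  obtain y where y: "y \<in> A" "y \<noteq> c"
  proof (rule ccontr)
    assume "\<not> thesis"
    then have "A \<subseteq> {c}" using that by auto
    then have "aff_dim A \<le> 0" using aff_dim_subset[of A "{c}"] by simp
    then show False using assms by simp
  qed
  show ?thesis
  proof
    fix x assume "x \<in> A"
    show "x \<in> H"
    proof (cases "x = c")
      case True then show ?thesis using line[OF y, of 0] by simp
    next
      case False then show ?thesis using line[OF \<open>x \<in> A\<close>, of 1] by simp
    qed
  qed
qed

text \<open>The section is nonempty and clopen in a sphere that is connected because
  \<open>k \<ge> 1\<close>. The subspace \<open>A\<close> of that sphere is at first unrelated to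
  \<open>H\<close>; the sphere spans it, so it lies in \<open>H\<close>, and equal dimensions give
  \<open>A = H\<close>.\<close>

lemma hyperplane_section_whole_sphere:
  fixes M :: "'a::euclidean_space set"
  assumes "compact M" "q \<in> M" "q \<in> H" and H: "hyperplane_with_unit_normal H u"
    and piece: "piece_of_round_sphere k r (M \<inter> H)"
    and "k + 2 = DIM('a)" "k \<ge> 1" "r > 0"
  obtains c where "c \<in> H" "M \<inter> H = H \<inter> sphere c r"
proof -
  obtain b where Hb: "H = {x. u \<bullet> x = b}" and u: "norm u = 1"
    using H unfolding hyperplane_with_unit_normal_def by auto
  obtain A c where A: "affine A" "aff_dim A = int k + 1" "c \<in> A"
    and op: "openin (top_of_set (A \<inter> sphere c r)) (M \<inter> H)"
    using piece unfolding piece_of_round_sphere_def round_sphere_def by auto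
  have "closed H" by (simp add: Hb closed_hyperplane)
  then have "closed (M \<inter> H)"
    using \<open>compact M\<close> by (simp add: closed_Int compact_imp_closed)
  then have "closedin (top_of_set (A \<inter> sphere c r)) (M \<inter> H)"
    using op by (auto intro!: closed_subset dest: openin_imp_subset)
  moreover have "connected (A \<inter> sphere c r)"
    using A assms by (intro connected_affine_Int_sphere) auto
  ultimately have eq: "M \<inter> H = A \<inter> sphere c r"
    using op assms by (auto simp: connected_clopen)
  have "affine H" by (simp add: Hb affine_hyperplane)
  have "A \<subseteq> H"
    using eq A assms \<open>affine H\<close> by (intro affine_subset_of_sphere_subset[of A H c r]) auto
  moreover have "aff_dim H = int k + 1"
    using assms u unfolding Hb by (subst aff_dim_hyperplane) auto
  ultimately have "A = H"
    using A \<open>affine H\<close> by (intro affine_dim_equal) auto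
  then show ?thesis using eq A that by auto
qed

section \<open>Orthogonal vectors and normal vectors\<close>

lemma exists_orthogonal_of_norm:
  fixes B :: "'a::euclidean_space set"
  assumes "finite B" "card B < DIM('a)" "r \<ge> 0"
  obtains v where "norm v = r" "\<And>b. b \<in> B \<Longrightarrow> b \<bullet> v = 0"
proof -
  have "dim B < DIM('a)"
    using assms dim_le_card'[of B] by linarith
  then obtain x where x: "x \<noteq> 0" "\<And>y. y \<in> span B \<Longrightarrow> orthogonal x y"
    by (rule orthogonal_to_subspace_exists) blast
  show ?thesis
  proof (rule that[of "(r / norm x) *\<^sub>R x"])
    show "norm ((r / norm x) *\<^sub>R x) = r" using x assms by simp
    show "b \<bullet> (r / norm x) *\<^sub>R x = 0" if "b \<in> B" for b
      using x(2)[OF span_base[OF that]] by (simp add: orthogonal_def inner_commute)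
  qed
qed

text \<open>First-order condition: along a curve in \<open>M\<close> through \<open>q\<close> with
  velocity \<open>v\<close>, \<open>f\<close> has a maximum at parameter 0, so the gradient
  \<open>a\<close> satisfies \<open>a \<bullet> v = 0\<close>.\<close>

lemma normal_line_of_maximum:
  fixes M :: "'a::euclidean_space set" and f :: "'a \<Rightarrow> real"
  assumes f: "(f has_derivative (\<lambda>h. a \<bullet> h)) (at q)" and max: "\<And>x. x \<in> M \<Longrightarrow> f x \<le> f q"
  shows "a \<in> normal_line M q"
  unfolding normal_line_def orthogonal_comp_def tangent_space_def mem_Collect_eq
proof clarify
  fix v :: 'a and e :: real and \<gamma> :: "real \<Rightarrow> 'a"
  assume e: "e > 0" and im: "\<gamma> ` {-e<..<e} \<subseteq> M" and q: "q = \<gamma> 0"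
    and d: "(\<gamma> has_vector_derivative v) (at 0)"
  have "((f \<circ> \<gamma>) has_derivative ((\<lambda>h. a \<bullet> h) \<circ> (\<lambda>t. t *\<^sub>R v))) (at 0)"
    using d f q unfolding has_vector_derivative_def by (intro diff_chain_at) auto
  moreover have "eventually (\<lambda>t. (f \<circ> \<gamma>) t \<le> (f \<circ> \<gamma>) 0) (at 0)"
    unfolding eventually_at using e im max q
    by (intro exI[of _ e]) (auto simp: image_subset_iff dist_real_def abs_less_iff)
  ultimately have "((\<lambda>h. a \<bullet> h) \<circ> (\<lambda>t. t *\<^sub>R v)) = (\<lambda>h. 0)"
    by (rule has_derivative_local_max)
  from fun_cong[OF this, of 1] show "orthogonal v a"
    by (simp add: orthogonal_def inner_commute)
qed

lemma direction_hyperplane: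
  assumes "q \<in> {x. u \<bullet> x = b}"
  shows "direction {x. u \<bullet> x = b} = {x. u \<bullet> x = 0}"
proof -
  have "\<exists>x y. z = x - y \<and> u \<bullet> x = b \<and> u \<bullet> y = b" if "u \<bullet> z = 0" for z
    using assms that by (intro exI[of _ "q + z"] exI[of _ q]) (auto simp: inner_add_right)
  then show ?thesis by (auto simp: direction_def inner_diff_right)
qed

section \<open>Normal sections determine the hypersurface\<close>

lemma normal_sections_imp_sphere:
  fixes M :: "'a::euclidean_space set"
  assumes "DIM('a) \<ge> 3" "r > 0" "compact M" "M \<noteq> {}"
    and sections: "\<And>q. q \<in> M \<Longrightarrow> \<exists>H u. hyperplane_with_unit_normal H u \<and>
      normal_hyperplane_at M q H \<and> piece_of_round_sphere (DIM('a) - 2) r (M \<inter> H)"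
  obtains c where "M = sphere c r"
proof -
  \<comment> \<open>Section data in vector form: \<open>u\<close> is the unit normal of the
    hyperplane and \<open>c\<close> the center of the section. The last clause describes the section
    as a sphere of vectors orthogonal to \<open>u\<close>, translated by \<open>c\<close>.\<close>
  have "\<exists>u c. u \<bullet> (q - c) = 0 \<and> norm (q - c) = r \<and> normal_line M q \<subseteq> {x. u \<bullet> x = 0} \<and>
      (\<forall>v. u \<bullet> v = 0 \<longrightarrow> (c + v \<in> M \<longleftrightarrow> norm v = r))" if q: "q \<in> M" for q
  proof -
    obtain H u where H: "hyperplane_with_unit_normal H u" "q \<in> H" "normal_line M q \<subseteq> direction H"
      "piece_of_round_sphere (DIM('a) - 2) r (M \<inter> H)"
      using sections[OF q] unfolding normal_hyperplane_at_def by auto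
    obtain c where c: "c \<in> H" "M \<inter> H = H \<inter> sphere c r"
      by (rule hyperplane_section_whole_sphere[OF \<open>compact M\<close> q H(2,1,4)]) (use assms in auto)
    obtain b where b: "H = {x. u \<bullet> x = b}"
      using H(1) unfolding hyperplane_with_unit_normal_def by auto
    have "normal_line M q \<subseteq> {x. u \<bullet> x = 0}"
      using H(2,3) direction_hyperplane[of q u b] unfolding b by simp
    moreover have "u \<bullet> (q - c) = 0"
      using H(2) c(1) by (simp add: b inner_diff_right)
    moreover have "norm (q - c) = r"
      using q H(2) c(2) by (auto simp: dist_norm norm_minus_commute)
    moreover have "c + v \<in> M \<longleftrightarrow> norm v = r" if "u \<bullet> v = 0" for v
    proof -
      have "c + v \<in> H" using c(1) that by (simp add: b inner_add_right)
      then have "c + v \<in> M \<longleftrightarrow> c + v \<in> sphere c r" using c(2) by blast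
      then show ?thesis by (simp add: dist_norm)
    qed
    ultimately show ?thesis by blast
  qed
  then obtain U C where ortho: "\<And>q. q \<in> M \<Longrightarrow> U q \<bullet> (q - C q) = 0"
    and rad: "\<And>q. q \<in> M \<Longrightarrow> norm (q - C q) = r"
    and normal: "\<And>q a. q \<in> M \<Longrightarrow> a \<in> normal_line M q \<Longrightarrow> U q \<bullet> a = 0"
    and mem: "\<And>q v. q \<in> M \<Longrightarrow> U q \<bullet> v = 0 \<Longrightarrow> C q + v \<in> M \<longleftrightarrow> norm v = r"
    by (simp only: subset_iff mem_Collect_eq) metis
  obtain p q where pq: "p \<in> M" "q \<in> M" "\<And>x y. x \<in> M \<Longrightarrow> y \<in> M \<Longrightarrow> dist x y \<le> dist p q"
    using compact_sup_maxdistance[OF \<open>compact M\<close> \<open>M \<noteq> {}\<close>] by (auto simp: dist_norm)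
  \<comment> \<open>This is the gradient at \<open>q\<close> of the squared distance to
    \<open>p\<close>, which is maximal on \<open>M\<close> at \<open>q\<close>.\<close>
  have "2 *\<^sub>R (q - p) \<in> normal_line M q"
  proof (rule normal_line_of_maximum)
    show "((\<lambda>x. (x - p) \<bullet> (x - p)) has_derivative (\<lambda>h. 2 *\<^sub>R (q - p) \<bullet> h)) (at q)"
      by (auto intro!: derivative_eq_intros simp: inner_commute)
    show "(x - p) \<bullet> (x - p) \<le> (q - p) \<bullet> (q - p)" if "x \<in> M" for x
      using pq(3)[OF that pq(1)] unfolding dist_norm norm_minus_commute[of p q] norm_le .
  qed
  then have "U q \<bullet> (q - p) = 0" using normal[OF pq(2)] by fastforce
  \<comment> \<open>\<open>q - p\<close> and \<open>q - C q\<close> are both orthogonal to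
    \<open>U q\<close>, hence so is their difference. Thus \<open>p\<close> lies on the section
    through \<open>q\<close>, and the triangle inequality via its center bounds the
    diameter.\<close>
  then have "U q \<bullet> (p - C q) = 0" using ortho[OF pq(2)] by (simp add: inner_diff_right)
  then have "norm (p - C q) = r" using mem[OF pq(2), of "p - C q"] pq(1) by simp
  then have "dist p q \<le> 2 * r"
    using rad[OF pq(2)] norm_triangle_ineq4[of "p - C q" "q - C q"] by (simp add: dist_norm)
  then have diam: "norm (x - y) \<le> 2 * r" if "x \<in> M" "y \<in> M" for x y
    using pq(3)[OF that] by (simp add: dist_norm)
  have same: "C x = C y" if xy: "x \<in> M" "y \<in> M" for x y
  proof -
    have "card {U x, U y} < DIM('a)"
      using assms(1) card_insert_le_m1[of 2 "{U y}" "U x"] by simp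
    then obtain v where v: "norm v = r" "U x \<bullet> v = 0" "U y \<bullet> v = 0"
      using exists_orthogonal_of_norm[of "{U x, U y}" r] \<open>r > 0\<close>
      by (metis finite.emptyI finite_insert insertCI less_imp_le)
    then have "C x + v \<in> M" "C x + (- v) \<in> M" "C y + v \<in> M" "C y + (- v) \<in> M"
      using mem[OF xy(1), of v] mem[OF xy(1), of "- v"] mem[OF xy(2), of v] mem[OF xy(2), of "- v"]
      by simp_all
    \<comment> \<open>Opposite signs are paired across the two sections, so that the differences are
      the two diagonals of a parallelogram.\<close>
    then have "norm ((C x - C y) + 2 *\<^sub>R v) \<le> 2 * r" "norm ((C x - C y) - 2 *\<^sub>R v) \<le> 2 * r"
      using diam[of "C x + v" "C y + (- v)"] diam[of "C x + (- v)" "C y + v"]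
      by (simp_all add: algebra_simps scaleR_2)
    then have "(norm ((C x - C y) + 2 *\<^sub>R v))\<^sup>2 \<le> (2 * r)\<^sup>2" "(norm ((C x - C y) - 2 *\<^sub>R v))\<^sup>2 \<le> (2 * r)\<^sup>2"
      by (simp_all only: power_mono norm_ge_zero)
    moreover have "(norm ((C x - C y) + 2 *\<^sub>R v))\<^sup>2 + (norm ((C x - C y) - 2 *\<^sub>R v))\<^sup>2
        = 2 * (norm (C x - C y))\<^sup>2 + 8 * (norm v)\<^sup>2"
      by (simp add: power2_norm_eq_inner inner_add_left inner_add_right inner_diff_left
          inner_diff_right inner_commute)
    ultimately have "(norm (C x - C y))\<^sup>2 \<le> 0"
      by (simp only: v(1) power_mult_distrib power2_eq_square[of "2::real"])
    then show ?thesis by simp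
  qed
  obtain c where c: "\<And>x. x \<in> M \<Longrightarrow> C x = c" using same \<open>M \<noteq> {}\<close> by blast
  have "sphere c r \<subseteq> M"
  proof
    fix y assume y: "y \<in> sphere c r"
    have "continuous_on M (\<lambda>z. (y - c) \<bullet> z)"
      by (intro continuous_intros)
    then obtain x where x: "x \<in> M" "\<And>z. z \<in> M \<Longrightarrow> (y - c) \<bullet> z \<le> (y - c) \<bullet> x"
      using continuous_attains_sup[OF \<open>compact M\<close> \<open>M \<noteq> {}\<close>] by blast
    \<comment> \<open>The linear form has gradient \<open>y - c\<close> everywhere. Being normal at
      \<open>x\<close>, this vector is orthogonal to \<open>U x\<close>; as it has length
      \<open>r\<close>, the section at \<open>x\<close> contains
      \<open>c + (y - c) = y\<close>.\<close>
    have "y - c \<in> normal_line M x"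
      using x(2) by (intro normal_line_of_maximum[where f = "\<lambda>z. (y - c) \<bullet> z"])
        (auto intro!: derivative_eq_intros)
    then have "C x + (y - c) \<in> M"
      using mem[OF x(1)] normal[OF x(1)] y by (simp add: dist_norm norm_minus_commute)
    then show "y \<in> M" using c[OF x(1)] by simp
  qed
  moreover have "M \<subseteq> sphere c r"
    using rad c by (auto simp: dist_norm norm_minus_commute)
  ultimately show ?thesis using that by blast
qed

section \<open>Great circles and normal sections of the round sphere\<close>

lemma smooth_on_cos_sin:
  fixes a b c :: "'a::real_normed_vector"
  shows "smooth_on S (\<lambda>t. c + cos t *\<^sub>R a + sin t *\<^sub>R b)"
proof -
  have "Ck_on k S (\<lambda>t. c + cos t *\<^sub>R a + sin t *\<^sub>R b)" for k
  proof (induction k arbitrary: a b c)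
    case 0
    show ?case by (auto intro!: continuous_intros)
  next
    case (Suc k)
    have d: "((\<lambda>t. c + cos t *\<^sub>R a + sin t *\<^sub>R b) has_vector_derivative
        cos x *\<^sub>R b - sin x *\<^sub>R a) (at x)" for x :: real
      by (auto intro!: derivative_eq_intros)
    \<comment> \<open>The derivative is put back into the original shape, with \<open>0\<close>,
      \<open>h *\<^sub>R b\<close> and \<open>- h *\<^sub>R a\<close> as the new vectors, so that
      the induction hypothesis applies.\<close>
    have "frechet_derivative (\<lambda>t. c + cos t *\<^sub>R a + sin t *\<^sub>R b) (at x) h =
        0 + cos x *\<^sub>R (h *\<^sub>R b) + sin x *\<^sub>R (- h *\<^sub>R a)" for x h :: real
      using frechet_derivative_at[OF d[unfolded has_vector_derivative_def], of x, symmetric]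
      by (simp add: algebra_simps)
    then show ?case
      using d Suc.IH unfolding Ck_on.simps differentiable_def has_vector_derivative_def
      by (simp only:) blast
  qed
  then show ?thesis by (simp add: smooth_on_def)
qed

text \<open>The great circle through \<open>q\<close> with initial velocity \<open>v\<close> stays
  on the sphere, because \<open>q - c\<close> and \<open>v\<close> are orthogonal and both of length
  \<open>r\<close>.\<close>

lemma tangent_space_sphere:
  fixes c q v :: "'a::euclidean_space"
  assumes "dist c q = r" "norm v = r" "(q - c) \<bullet> v = 0"
  shows "v \<in> tangent_space (sphere c r) q"
proof -
  let ?g = "\<lambda>t::real. c + cos t *\<^sub>R (q - c) + sin t *\<^sub>R v"
  have n: "(q - c) \<bullet> (q - c) = r\<^sup>2" "v \<bullet> v = r\<^sup>2"
    using assms by (auto simp: dist_norm norm_minus_commute simp flip: power2_norm_eq_inner)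
  have "r \<ge> 0" using assms by auto
  have "dist c (?g t) = r" for t
  proof -
    have "(norm (cos t *\<^sub>R (q - c) + sin t *\<^sub>R v))\<^sup>2
        = (cos t)\<^sup>2 * ((q - c) \<bullet> (q - c)) + (sin t)\<^sup>2 * (v \<bullet> v) + 2 * (cos t * sin t) * ((q - c) \<bullet> v)"
      unfolding power2_norm_eq_inner inner_add_left inner_add_right inner_scaleR_left inner_scaleR_right
      by (simp only: inner_commute[of v "q - c"]) algebra
    also have "\<dots> = ((cos t)\<^sup>2 + (sin t)\<^sup>2) * r\<^sup>2"
      by (simp only: n assms(3)) algebra
    finally have "norm (cos t *\<^sub>R (q - c) + sin t *\<^sub>R v) = r"
      using \<open>r \<ge> 0\<close> by simp
    moreover have "?g t - c = cos t *\<^sub>R (q - c) + sin t *\<^sub>R v" by simp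
    ultimately show ?thesis by (metis dist_commute dist_norm)
  qed
  then have "?g ` {-1<..<1} \<subseteq> sphere c r" by auto
  moreover have "(?g has_vector_derivative v) (at 0)"
    by (auto intro!: derivative_eq_intros)
  ultimately show ?thesis
    unfolding tangent_space_def mem_Collect_eq
    by (intro exI[of _ 1] conjI exI[of _ ?g]) (auto simp: smooth_on_cos_sin)
qed

text \<open>As \<open>u\<close> is tangent at \<open>q\<close>, the hyperplane through
  \<open>q\<close> orthogonal to \<open>u\<close> passes through the center \<open>c\<close> and
  cuts out a great sphere, of the same radius \<open>r\<close>. It is normal because the normal line
  is orthogonal to \<open>u\<close>.\<close>

lemma normal_section_of_sphere:
  fixes c q u :: "'a::euclidean_space"
  assumes "r > 0" "q \<in> sphere c r" "norm u = 1" "(q - c) \<bullet> u = 0" "DIM('a) \<ge> 2"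
    and H: "H = {x. u \<bullet> x = u \<bullet> q}"
  shows "hyperplane_with_unit_normal H u" "normal_hyperplane_at (sphere c r) q H"
    "piece_of_round_sphere (DIM('a) - 2) r (sphere c r \<inter> H)"
proof -
  show "hyperplane_with_unit_normal H u"
    using assms by (auto simp: hyperplane_with_unit_normal_def)
  have "r *\<^sub>R u \<in> tangent_space (sphere c r) q"
    using assms by (intro tangent_space_sphere) auto
  then have "normal_line (sphere c r) q \<subseteq> {x. u \<bullet> x = 0}"
    using \<open>r > 0\<close> by (force simp: normal_line_def orthogonal_comp_def orthogonal_def)
  also have "\<dots> = direction H"
    unfolding H by (rule direction_hyperplane[symmetric, of q]) simp
  finally show "normal_hyperplane_at (sphere c r) q H"
    by (simp add: normal_hyperplane_at_def H)
  have "u \<noteq> 0" using assms by auto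
  then have "aff_dim H = int (DIM('a) - 2) + 1"
    using assms(5) unfolding H by (subst aff_dim_hyperplane) auto
  moreover have "c \<in> H"
    using assms(4) by (simp add: H inner_diff_left inner_commute[of u])
  moreover have "affine H" by (simp add: H affine_hyperplane)
  ultimately have "round_sphere (DIM('a) - 2) r (sphere c r \<inter> H)"
    unfolding round_sphere_def by (intro exI[of _ H] exI[of _ c]) auto
  then show "piece_of_round_sphere (DIM('a) - 2) r (sphere c r \<inter> H)"
    unfolding piece_of_round_sphere_def by (meson openin_subtopology_self)
qed

section \<open>The equivalence for hypersurfaces\<close>

lemma round_sphere_full_dimension:
  fixes S :: "'a::euclidean_space set"
  assumes "k + 1 = DIM('a)"
  shows "round_sphere k r S \<longleftrightarrow> (\<exists>c. S = sphere c r)"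
proof -
  have "affine A \<and> aff_dim A = int k + 1 \<longleftrightarrow> A = UNIV" for A :: "'a set"
    using assms aff_dim_eq_full[of A] affine_hull_eq[of A] by fastforce
  then show ?thesis unfolding round_sphere_def by (metis Int_UNIV_left UNIV_I)
qed

theorem corollary16:
  fixes m :: nat and r :: real and \<Sigma> :: "(real ^ 'n) set"
  assumes "m \<ge> 2" and "r > 0" and "CARD('n) = m + 1"
    and "hypersurface \<Sigma>" and "compact \<Sigma>" and "connected \<Sigma>" and "\<Sigma> \<noteq> {}"
  shows "round_sphere m r \<Sigma> \<longleftrightarrow>
    (\<forall>q\<in>\<Sigma>. \<exists>H\<^sub>1 H\<^sub>2 u\<^sub>1 u\<^sub>2.
        hyperplane_with_unit_normal H\<^sub>1 u\<^sub>1 \<and> hyperplane_with_unit_normal H\<^sub>2 u\<^sub>2 \<and> u\<^sub>1 \<bullet> u\<^sub>2 = 0 \<and>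
        normal_hyperplane_at \<Sigma> q H\<^sub>1 \<and> normal_hyperplane_at \<Sigma> q H\<^sub>2 \<and>
        piece_of_round_sphere (m - 1) r (\<Sigma> \<inter> H\<^sub>1) \<and>
        piece_of_round_sphere (m - 1) r (\<Sigma> \<inter> H\<^sub>2))"
    (is "?sphere \<longleftrightarrow> ?sections")
proof
  have dim: "DIM(real ^ 'n) = m + 1" using assms by simp
  then have m1: "DIM(real ^ 'n) - 2 = m - 1" by linarith
  have round: "?sphere \<longleftrightarrow> (\<exists>c. \<Sigma> = sphere c r)"
    using dim by (intro round_sphere_full_dimension) simp
  show ?sections if ?sphere
  proof
    fix q assume q: "q \<in> \<Sigma>"
    obtain c where c: "\<Sigma> = sphere c r" using \<open>?sphere\<close> round by blast
    obtain u where u: "norm u = 1" "(q - c) \<bullet> u = 0"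
      using exists_orthogonal_of_norm[of "{q - c}" 1] dim assms(1) by auto
    \<comment> \<open>Dimension at least 3 leaves room for a second unit tangent vector
      \<open>w\<close> orthogonal to \<open>u\<close>; both then serve as normals of hyperplanes
      through \<open>q\<close>.\<close>
    have "card {q - c, u} < DIM(real ^ 'n)"
      using dim assms(1) card_insert_le_m1[of 2 "{u}" "q - c"] by simp
    then obtain w where w: "norm w = 1" "(q - c) \<bullet> w = 0" "u \<bullet> w = 0"
      using exists_orthogonal_of_norm[of "{q - c, u}" 1]
      by (metis finite.emptyI finite_insert insertCI zero_le_one)
    note normal_section = normal_section_of_sphere[OF \<open>r > 0\<close> q[unfolded c] _ _ _ refl, folded c, unfolded m1]
    show "\<exists>H\<^sub>1 H\<^sub>2 u\<^sub>1 u\<^sub>2.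
        hyperplane_with_unit_normal H\<^sub>1 u\<^sub>1 \<and> hyperplane_with_unit_normal H\<^sub>2 u\<^sub>2 \<and> u\<^sub>1 \<bullet> u\<^sub>2 = 0 \<and>
        normal_hyperplane_at \<Sigma> q H\<^sub>1 \<and> normal_hyperplane_at \<Sigma> q H\<^sub>2 \<and>
        piece_of_round_sphere (m - 1) r (\<Sigma> \<inter> H\<^sub>1) \<and>
        piece_of_round_sphere (m - 1) r (\<Sigma> \<inter> H\<^sub>2)"
      using normal_section[OF u] normal_section[OF w(1,2)] w(3) dim assms(1)
      by (intro exI[of _ "{x. u \<bullet> x = u \<bullet> q}"] exI[of _ "{x. w \<bullet> x = w \<bullet> q}"]
          exI[of _ u] exI[of _ w]) auto
  qed
  show ?sphere if ?sections
  proof -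
    have "\<exists>H u. hyperplane_with_unit_normal H u \<and> normal_hyperplane_at \<Sigma> q H \<and>
        piece_of_round_sphere (DIM(real ^ 'n) - 2) r (\<Sigma> \<inter> H)" if "q \<in> \<Sigma>" for q
      using \<open>?sections\<close> that unfolding m1 by blast
    then obtain c where "\<Sigma> = sphere c r"
      using normal_sections_imp_sphere[of r \<Sigma>] dim assms by auto
    then show ?thesis using round by blast
  qed
qed

end
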